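(* (a) For all integers $n,r$ with $n-1\geq r\geq1$, $$J_n^{(r)}(q)=\sum [r]_q^{\,u_1}[u_1]_q^{\,u_2}\cdots[u_{k-1}]_q^{\,u_k}\,q^{n(u')}\binom{n-r}{u_1,u_2,\dots,u_k},$$ where the sum is over all $k\geq1$ and all $k$-tuples $u=(u_1,\dots,u_k)$ of strictly positive integers with $u_1+\dots+u_k=n-r$, $n(u')=\sum_{i=1}^k\binom{u_i}{2}$, and $\binom{n-r}{u_1,\dots,u_k}$ is the multinomial coefficient. (b) For all integers $n\geq r\geq0$, $$J_n^{(r)}(q)=(n-r)!\sum [r]_q^{\,u_1}\,q^{n(u')}\prod_{i\geq1}\frac{[u_i]_q^{\,u_{i+1}}}{u_i!},$$ where the sum is over all sequences $u=(u_i)_{i\geq1}$ of nonnegative integers, only finitely many nonzero, with $\sum_{i\geq1}u_i=n-r$, and $n(u')=\sum_{i\geq1}\binom{u_i}{2}$.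
   Context: Let $\Lambda$ be the ring of symmetric functions in infinitely many variables with coefficients in $\mathbb{Q}(q)$; $e_n$ are the elementary symmetric functions and $m_\lambda$ the monomial symmetric functions. For $n\geq r\geq1$, $p_n^{(r)}=\sum m_\lambda$ over all partitions $\lambda$ of $n$ with exactly $r$ parts. Let $\varphi:\Lambda\to\mathbb{Q}(q)$ be the $\mathbb{Q}(q)$-algebra homomorphism with $\varphi(e_n)=q^{\binom n2}/n!$ for $n\geq1$. For $n\geq r\geq1$ define $J_n^{(r)}(q)$ by $\varphi(p_n^{(r)})=(1-q)^{n-r}\frac{q^{\binom r2}}{r!\,(n-r)!}J_n^{(r)}(q)$, and set $J_n^{(0)}=\delta_{n,0}$ for $n\geq0$. Here $[k]_q=1+q+\dots+q^{k-1}$ for $k\geq1$, $[0]_q=0$, with $[0]_q^0=1$ and $0!=1$. *)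

theory Defs
  imports
    "HOL-Computational_Algebra.Computational_Algebra"
    "HOL-Library.Multiset"
    "HOL-Library.Poly_Mapping"
begin

text \<open>
  The monomial \<open>x\<^sub>0\<^bsup>\<alpha> 0\<^esup> x\<^sub>1\<^bsup>\<alpha> 1\<^esup> \<dots>\<close> is represented by its exponent vector \<open>\<alpha> :: nat \<Rightarrow>\<^sub>0 nat\<close>,
  and a formal power series in \<open>x\<^sub>0, x\<^sub>1, \<dots>\<close> by its coefficient function.
\<close>

type_synonym mono = "nat \<Rightarrow>\<^sub>0 nat"

definition mono_degree :: "mono \<Rightarrow> nat" where
  "mono_degree \<alpha> = (\<Sum>i\<in>Poly_Mapping.keys \<alpha>. Poly_Mapping.lookup \<alpha> i)"

definition conv :: "(mono \<Rightarrow> 'a::comm_semiring_1) \<Rightarrow> (mono \<Rightarrow> 'a) \<Rightarrow> mono \<Rightarrow> 'a" where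
  "conv f g \<gamma> = (\<Sum>(\<alpha>, \<beta>) | \<alpha> + \<beta> = \<gamma>. f \<alpha> * g \<beta>)"

text \<open>Elements of \<open>\<Lambda>\<close>: series of bounded degree invariant under all permutations of the variables.\<close>

definition is_symfun :: "(mono \<Rightarrow> 'a::zero) \<Rightarrow> bool" where
  "is_symfun f \<longleftrightarrow>
     (\<exists>d. \<forall>\<alpha>. f \<alpha> \<noteq> 0 \<longrightarrow> mono_degree \<alpha> \<le> d) \<and>
     (\<forall>\<sigma> \<alpha>. bij \<sigma> \<longrightarrow> f (Poly_Mapping.map_key \<sigma> \<alpha>) = f \<alpha>)"


subsection \<open>Closure properties\<close>

lemma mono_degree_superset:
  assumes "finite A" "Poly_Mapping.keys \<alpha> \<subseteq> A"
  shows "mono_degree \<alpha> = (\<Sum>i\<in>A. Poly_Mapping.lookup \<alpha> i)"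
  unfolding mono_degree_def
  by (rule sum.mono_neutral_left) (use assms in \<open>auto simp: in_keys_iff\<close>)

lemma mono_degree_0 [simp]: "mono_degree 0 = 0"
  by (simp add: mono_degree_def)

lemma mono_degree_add: "mono_degree (\<alpha> + \<beta>) = mono_degree \<alpha> + mono_degree \<beta>"
proof -
  let ?A = "Poly_Mapping.keys \<alpha> \<union> Poly_Mapping.keys \<beta>"
  have "Poly_Mapping.keys (\<alpha> + \<beta>) \<subseteq> ?A" by (rule Poly_Mapping.keys_add)
  then show ?thesis
    by (simp add: mono_degree_superset[of ?A] lookup_add sum.distrib)
qed

lemma lookup_le_mono_degree: "Poly_Mapping.lookup \<alpha> i \<le> mono_degree \<alpha>"
proof (cases "i \<in> Poly_Mapping.keys \<alpha>")
  case True
  then show ?thesis unfolding mono_degree_def by (intro member_le_sum) auto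
qed (simp add: in_keys_iff)

lemma finite_monos:
  assumes "finite A"
  shows "finite {\<alpha>::mono. Poly_Mapping.keys \<alpha> \<subseteq> A \<and> (\<forall>i. Poly_Mapping.lookup \<alpha> i \<le> N)}" (is "finite ?S")
proof (rule finite_imageD)
  show "inj_on Poly_Mapping.lookup ?S"
    by (auto intro!: inj_onI poly_mapping_eqI)
  have "Poly_Mapping.lookup ` ?S \<subseteq> {f. \<forall>x. (x \<in> A \<longrightarrow> f x \<in> {..N}) \<and> (x \<notin> A \<longrightarrow> f x = 0)}"
    by (auto simp: in_keys_iff subset_iff)
  then show "finite (Poly_Mapping.lookup ` ?S)"
    by (rule finite_subset) (intro finite_set_of_finite_funs assms finite_atMost)
qed

lemma finite_add_eq: "finite {(\<alpha>::mono, \<beta>). \<alpha> + \<beta> = \<gamma>}"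
proof -
  let ?S = "{\<alpha>::mono. Poly_Mapping.keys \<alpha> \<subseteq> Poly_Mapping.keys \<gamma> \<and>
              (\<forall>i. Poly_Mapping.lookup \<alpha> i \<le> mono_degree \<gamma>)}"
  have "\<alpha> \<in> ?S \<and> \<beta> \<in> ?S" if "\<alpha> + \<beta> = \<gamma>" for \<alpha> \<beta>
  proof -
    have "Poly_Mapping.lookup \<alpha> i \<le> mono_degree \<gamma>" "Poly_Mapping.lookup \<beta> i \<le> mono_degree \<gamma>" for i
      using lookup_le_mono_degree[of \<gamma> i] that by (auto simp: lookup_add)
    moreover have "Poly_Mapping.keys \<alpha> \<subseteq> Poly_Mapping.keys \<gamma>" "Poly_Mapping.keys \<beta> \<subseteq> Poly_Mapping.keys \<gamma>"
      unfolding that[symmetric] by (simp_all add: subset_iff in_keys_iff lookup_add)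
    ultimately show ?thesis by simp
  qed
  then have "{(\<alpha>, \<beta>). \<alpha> + \<beta> = \<gamma>} \<subseteq> ?S \<times> ?S" by blast
  then show ?thesis
    by (rule finite_subset) (intro finite_cartesian_product finite_monos finite_keys)
qed

lemma lookup_map_key:
  fixes \<sigma> :: "nat \<Rightarrow> nat" and \<alpha> :: mono
  assumes "inj \<sigma>"
  shows "Poly_Mapping.lookup (Poly_Mapping.map_key \<sigma> \<alpha>) i = Poly_Mapping.lookup \<alpha> (\<sigma> i)"
  by (simp add: Poly_Mapping.map_key.rep_eq[OF assms])

lemma map_key_inverse:
  fixes \<sigma> :: "nat \<Rightarrow> nat" and \<alpha> :: mono
  assumes "bij \<sigma>"
  shows "Poly_Mapping.map_key (inv \<sigma>) (Poly_Mapping.map_key \<sigma> \<alpha>) = \<alpha>"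
    and "Poly_Mapping.map_key \<sigma> (Poly_Mapping.map_key (inv \<sigma>) \<alpha>) = \<alpha>"
proof -
  have "inj \<sigma>" "inj (inv \<sigma>)" using assms bij_imp_bij_inv bij_is_inj by blast+
  then show "Poly_Mapping.map_key (inv \<sigma>) (Poly_Mapping.map_key \<sigma> \<alpha>) = \<alpha>"
    and "Poly_Mapping.map_key \<sigma> (Poly_Mapping.map_key (inv \<sigma>) \<alpha>) = \<alpha>"
    using assms by (auto intro!: poly_mapping_eqI simp: lookup_map_key bij_is_surj surj_f_inv_f)
qed

lemma map_key_0_iff:
  fixes \<sigma> :: "nat \<Rightarrow> nat" and \<alpha> :: mono
  assumes "bij \<sigma>"
  shows "Poly_Mapping.map_key \<sigma> \<alpha> = 0 \<longleftrightarrow> \<alpha> = 0"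
proof
  assume "Poly_Mapping.map_key \<sigma> \<alpha> = 0"
  then have "Poly_Mapping.map_key (inv \<sigma>) 0 = \<alpha>"
    using map_key_inverse(1)[OF assms, of \<alpha>] by simp
  then show "\<alpha> = 0"
    by (simp add: map_key_zero[OF bij_is_inj[OF bij_imp_bij_inv[OF assms]]])
next
  assume "\<alpha> = 0"
  then show "Poly_Mapping.map_key \<sigma> \<alpha> = 0"
    by (simp add: map_key_zero[OF bij_is_inj[OF assms]])
qed

lemma keys_map_key_bij:
  fixes \<sigma> :: "nat \<Rightarrow> nat" and \<alpha> :: mono
  assumes "bij \<sigma>"
  shows "bij_betw \<sigma> (Poly_Mapping.keys (Poly_Mapping.map_key \<sigma> \<alpha>)) (Poly_Mapping.keys \<alpha>)"
  unfolding keys_map_key[OF bij_is_inj[OF assms]]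
proof (rule bij_betw_imageI)
  show "inj_on \<sigma> (\<sigma> -` Poly_Mapping.keys \<alpha>)"
    using bij_is_inj[OF assms] by (rule inj_on_subset) simp
  show "\<sigma> ` (\<sigma> -` Poly_Mapping.keys \<alpha>) = Poly_Mapping.keys \<alpha>"
    using bij_is_surj[OF assms] by (rule surj_image_vimage_eq)
qed

lemma mono_degree_map_key:
  fixes \<sigma> :: "nat \<Rightarrow> nat" and \<alpha> :: mono
  assumes "bij \<sigma>"
  shows "mono_degree (Poly_Mapping.map_key \<sigma> \<alpha>) = mono_degree \<alpha>"
  unfolding mono_degree_def
  using sum.reindex_bij_betw[OF keys_map_key_bij[OF assms], of "Poly_Mapping.lookup \<alpha>" \<alpha>]
  by (simp add: lookup_map_key[OF bij_is_inj[OF assms]])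

lemma conv_commute: "conv f g = conv g f"
  unfolding conv_def
  by (intro ext sum.reindex_bij_witness[of _ prod.swap prod.swap]) (auto simp: ac_simps)

lemma conv_add_left: "conv (\<lambda>\<alpha>. f \<alpha> + f' \<alpha>) g \<gamma> = conv f g \<gamma> + conv f' g \<gamma>"
  unfolding conv_def sum.distrib[symmetric]
  by (intro sum.cong) (auto simp: algebra_simps)

lemma conv_one_left: "conv (\<lambda>\<alpha>. if \<alpha> = 0 then 1 else 0) g = g"
proof
  fix \<gamma>
  have "(\<Sum>p \<in> {(\<alpha>, \<beta>). \<alpha> + \<beta> = \<gamma>}. (if fst p = 0 then 1 else 0) * g (snd p)) =
        (\<Sum>p \<in> {(0::mono, \<gamma>)}. (if fst p = 0 then 1 else 0) * g (snd p))"
    by (rule sum.mono_neutral_right[OF finite_add_eq]) auto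
  then show "conv (\<lambda>\<alpha>. if \<alpha> = 0 then 1 else 0) g \<gamma> = g \<gamma>"
    by (simp add: conv_def case_prod_unfold)
qed

lemma conv_assoc: "conv (conv f g) h = conv f (conv g h)"
proof
  fix \<delta> :: mono
  let ?S = "\<lambda>\<gamma>::mono. {(\<alpha>, \<beta>). \<alpha> + \<beta> = \<gamma>}"
  have fin: "finite (?S \<gamma>)" for \<gamma> by (rule finite_add_eq)
  have "conv (conv f g) h \<delta> =
      (\<Sum>p\<in>?S \<delta>. \<Sum>s\<in>?S (fst p). f (fst s) * g (snd s) * h (snd p))"
    unfolding conv_def by (simp add: case_prod_unfold sum_distrib_right)
  also have "\<dots> = (\<Sum>(p, s)\<in>Sigma (?S \<delta>) (\<lambda>p. ?S (fst p)). f (fst s) * g (snd s) * h (snd p))"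
    by (rule sum.Sigma) (use fin in auto)
  also have "\<dots> = (\<Sum>(p, s)\<in>Sigma (?S \<delta>) (\<lambda>p. ?S (snd p)). f (fst p) * (g (fst s) * h (snd s)))"
    by (rule sum.reindex_bij_witness[of _
          "\<lambda>(p, s). ((fst p + fst s, snd s), (fst p, fst s))"
          "\<lambda>(p, s). ((fst s, snd s + snd p), (snd s, snd p))"])
       (auto simp: algebra_simps)
  also have "\<dots> = (\<Sum>p\<in>?S \<delta>. \<Sum>s\<in>?S (snd p). f (fst p) * (g (fst s) * h (snd s)))"
    by (rule sum.Sigma[symmetric]) (use fin in auto)
  also have "\<dots> = conv f (conv g h) \<delta>"
    unfolding conv_def by (simp add: case_prod_unfold sum_distrib_left)
  finally show "conv (conv f g) h \<delta> = conv f (conv g h) \<delta>" .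
qed

lemma is_symfun_conv:
  assumes "is_symfun f" "is_symfun g"
  shows "is_symfun (conv f g)"
proof -
  from assms obtain d d' where
    d: "\<And>\<alpha>. f \<alpha> \<noteq> 0 \<Longrightarrow> mono_degree \<alpha> \<le> d" "\<And>\<alpha>. g \<alpha> \<noteq> 0 \<Longrightarrow> mono_degree \<alpha> \<le> d'"
    unfolding is_symfun_def by blast
  have "mono_degree \<gamma> \<le> d + d'" if "conv f g \<gamma> \<noteq> 0" for \<gamma>
  proof -
    from that obtain \<alpha> \<beta> where "\<alpha> + \<beta> = \<gamma>" "f \<alpha> * g \<beta> \<noteq> 0"
      unfolding conv_def by (auto elim!: sum.not_neutral_contains_not_neutral)
    moreover from this have "f \<alpha> \<noteq> 0" "g \<beta> \<noteq> 0" by auto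
    ultimately show ?thesis using d by (auto simp: mono_degree_add intro!: add_mono)
  qed
  moreover have "conv f g (Poly_Mapping.map_key \<sigma> \<gamma>) = conv f g \<gamma>" if "bij \<sigma>" for \<sigma> \<gamma>
  proof -
    let ?P = "\<lambda>\<sigma>. map_prod (Poly_Mapping.map_key \<sigma>) (Poly_Mapping.map_key \<sigma>)"
    have inj: "inj \<sigma>" "inj (inv \<sigma>)" using that bij_imp_bij_inv bij_is_inj by blast+
    have inv: "f (Poly_Mapping.map_key (inv \<sigma>) \<alpha>) = f \<alpha>" "g (Poly_Mapping.map_key (inv \<sigma>) \<alpha>) = g \<alpha>"
      for \<alpha> using assms that bij_imp_bij_inv[OF that] unfolding is_symfun_def by auto
    show ?thesis unfolding conv_def
      by (rule sum.reindex_bij_witness[of _ "?P \<sigma>" "?P (inv \<sigma>)"])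
         (auto simp: map_key_inverse[OF that] inv map_key_plus[OF inj(1), symmetric]
            map_key_plus[OF inj(2), symmetric])
  qed
  ultimately show ?thesis unfolding is_symfun_def by blast
qed


subsection \<open>The ring of symmetric functions\<close>

typedef (overloaded) 'a symfun = "{f :: mono \<Rightarrow> 'a::zero. is_symfun f}"
  morphisms symcoeff Abs_symfun
  by (rule exI[of _ "\<lambda>_. 0"]) (simp add: is_symfun_def)

setup_lifting type_definition_symfun

lemma symfun_eqI: "(\<And>\<alpha>. symcoeff f \<alpha> = symcoeff g \<alpha>) \<Longrightarrow> f = g"
  by (metis ext symcoeff_inject)

instantiation symfun :: (comm_ring_1) comm_ring_1
begin

lift_definition zero_symfun :: "'a symfun" is "\<lambda>_. 0"
  by (simp add: is_symfun_def)

lift_definition one_symfun :: "'a symfun" is "\<lambda>\<alpha>. if \<alpha> = 0 then 1 else 0"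
  by (auto simp: is_symfun_def map_key_0_iff intro!: exI[of _ 0])

lift_definition plus_symfun :: "'a symfun \<Rightarrow> 'a symfun \<Rightarrow> 'a symfun" is "\<lambda>f g \<alpha>. f \<alpha> + g \<alpha>"
proof -
  fix f g :: "mono \<Rightarrow> 'a"
  assume fg: "is_symfun f" "is_symfun g"
  then obtain d d' where "\<And>\<alpha>. f \<alpha> \<noteq> 0 \<Longrightarrow> mono_degree \<alpha> \<le> d" "\<And>\<alpha>. g \<alpha> \<noteq> 0 \<Longrightarrow> mono_degree \<alpha> \<le> d'"
    unfolding is_symfun_def by blast
  then have "\<forall>\<alpha>. f \<alpha> + g \<alpha> \<noteq> 0 \<longrightarrow> mono_degree \<alpha> \<le> max d d'"
    by (metis add.right_neutral le_max_iff_disj)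
  with fg show "is_symfun (\<lambda>\<alpha>. f \<alpha> + g \<alpha>)" unfolding is_symfun_def by auto
qed

lift_definition uminus_symfun :: "'a symfun \<Rightarrow> 'a symfun" is "\<lambda>f \<alpha>. - f \<alpha>"
  by (simp add: is_symfun_def)

definition minus_symfun :: "'a symfun \<Rightarrow> 'a symfun \<Rightarrow> 'a symfun" where
  "minus_symfun f g = f + - g"

lift_definition times_symfun :: "'a symfun \<Rightarrow> 'a symfun \<Rightarrow> 'a symfun" is conv
  by (rule is_symfun_conv)

instance
proof
  fix f g h :: "'a symfun"
  show "f + g + h = f + (g + h)" by transfer (simp add: add.assoc)
  show "f + g = g + f" by transfer (simp add: add.commute)
  show "0 + f = f" by transfer simp
  show "- f + f = 0" by transfer simp
  show "f - g = f + - g" by (rule minus_symfun_def)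
  show "f * g * h = f * (g * h)" by transfer (rule conv_assoc)
  show "f * g = g * f" by transfer (rule conv_commute)
  show "1 * f = f" by transfer (rule conv_one_left)
  show "(f + g) * h = f * h + g * h" by transfer (rule ext, rule conv_add_left)
  show "(0 :: 'a symfun) \<noteq> 1" by transfer (auto simp: fun_eq_iff)
qed

end

lift_definition sym_scale :: "'a::comm_ring_1 \<Rightarrow> 'a symfun \<Rightarrow> 'a symfun" is "\<lambda>c f \<alpha>. c * f \<alpha>"
  unfolding is_symfun_def by (metis mult_zero_right)

definition alg_hom :: "('a::comm_ring_1 symfun \<Rightarrow> 'a) \<Rightarrow> bool" where
  "alg_hom \<phi> \<longleftrightarrow>
     (\<forall>f g. \<phi> (f + g) = \<phi> f + \<phi> g) \<and>
     (\<forall>f g. \<phi> (f * g) = \<phi> f * \<phi> g) \<and>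
     (\<forall>c f. \<phi> (sym_scale c f) = c * \<phi> f) \<and>
     \<phi> 1 = 1"

text \<open>\<open>elem_sym n\<close> is the sum of all squarefree monomials of degree \<open>n\<close>.\<close>

lift_definition elem_sym :: "nat \<Rightarrow> 'a::comm_ring_1 symfun" is
  "\<lambda>n \<alpha>. if (\<forall>i. Poly_Mapping.lookup \<alpha> i \<le> 1) \<and> mono_degree \<alpha> = n then 1 else 0"
proof -
  fix n
  have "(\<forall>i. Poly_Mapping.lookup \<alpha> (\<sigma> i) \<le> 1) \<longleftrightarrow> (\<forall>i. Poly_Mapping.lookup \<alpha> i \<le> 1)"
    if "bij \<sigma>" for \<sigma> :: "nat \<Rightarrow> nat" and \<alpha> :: mono
    using that by (metis bij_pointE)
  then show "is_symfun (\<lambda>\<alpha>. if (\<forall>i. Poly_Mapping.lookup \<alpha> i \<le> 1) \<and> mono_degree \<alpha> = n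
        then 1 else (0::'a))"
    by (auto simp: is_symfun_def mono_degree_map_key lookup_map_key bij_is_inj intro!: exI[of _ n])
qed

text \<open>The multiset of nonzero exponents of a monomial.\<close>

definition shape :: "mono \<Rightarrow> nat multiset" where
  "shape \<alpha> = image_mset (Poly_Mapping.lookup \<alpha>) (mset_set (Poly_Mapping.keys \<alpha>))"

lemma shape_map_key:
  fixes \<sigma> :: "nat \<Rightarrow> nat" and \<alpha> :: mono
  assumes "bij \<sigma>"
  shows "shape (Poly_Mapping.map_key \<sigma> \<alpha>) = shape \<alpha>"
proof -
  let ?K = "Poly_Mapping.keys (Poly_Mapping.map_key \<sigma> \<alpha>)"
  note b = keys_map_key_bij[OF assms, of \<alpha>]
  have "mset_set (Poly_Mapping.keys \<alpha>) = image_mset \<sigma> (mset_set ?K)"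
    using b by (metis bij_betw_def image_mset_mset_set)
  then show ?thesis
    unfolding shape_def
    by (simp add: multiset.map_comp comp_def, intro image_mset_cong lookup_map_key bij_is_inj assms)
qed

lemma sum_mset_shape: "sum_mset (shape \<alpha>) = mono_degree \<alpha>"
  by (simp add: shape_def mono_degree_def sum_unfold_sum_mset)

text \<open>Partitions are the multisets of their (positive) parts.\<close>

lift_definition mono_sym :: "nat multiset \<Rightarrow> 'a::comm_ring_1 symfun" is
  "\<lambda>\<mu> \<alpha>. if shape \<alpha> = \<mu> then 1 else 0"
proof -
  fix \<mu> :: "nat multiset"
  show "is_symfun (\<lambda>\<alpha>. if shape \<alpha> = \<mu> then 1 else (0::'a))"
    by (auto simp: is_symfun_def shape_map_key sum_mset_shape[symmetric])
qed

definition partitions :: "nat \<Rightarrow> nat \<Rightarrow> nat multiset set" where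
  "partitions n r = {\<mu>. 0 \<notin># \<mu> \<and> sum_mset \<mu> = n \<and> size \<mu> = r}"

lemma finite_partitions: "finite (partitions n r)"
proof (rule finite_subset)
  have "set_mset \<mu> \<subseteq> {..n}" if "sum_mset \<mu> = n" for \<mu> :: "nat multiset"
    using that by (auto dest!: multi_member_split)
  then show "partitions n r \<subseteq> mset ` {xs. set xs \<subseteq> {..n} \<and> length xs = r}"
    unfolding partitions_def
    by (smt (verit, best) ex_mset imageI mem_Collect_eq set_mset_mset size_mset subsetI)
  show "finite (mset ` {xs. set xs \<subseteq> {..n} \<and> length xs = r})"
    by (intro finite_imageI finite_lists_length_eq) simp
qed

definition p_sym :: "nat \<Rightarrow> nat \<Rightarrow> 'a::comm_ring_1 symfun" where
  "p_sym n r = (\<Sum>\<mu>\<in>partitions n r. mono_sym \<mu>)"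


subsection \<open>The polynomials \<open>J\<close>\<close>

type_synonym qrat = "rat poly fract"

definition qv :: qrat where
  "qv = Fract [:0, 1:] 1"

definition q_int :: "nat \<Rightarrow> qrat" where
  "q_int k = (\<Sum>i<k. qv ^ i)"

definition J :: "(qrat symfun \<Rightarrow> qrat) \<Rightarrow> nat \<Rightarrow> nat \<Rightarrow> qrat" where
  "J \<phi> n r =
     (if r = 0 then (if n = 0 then 1 else 0)
      else \<phi> (p_sym n r) /
           ((1 - qv) ^ (n - r) * (qv ^ (r choose 2) / (of_nat (fact r) * of_nat (fact (n - r))))))"

lemma qv_neq_0: "qv \<noteq> 0"
  by (simp add: qv_def Zero_fract_def eq_fract)

lemma qv_neq_1: "qv \<noteq> 1"
  by (simp add: qv_def One_fract_def eq_fract one_pCons)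

lemma of_nat_fract: "(of_nat n :: 'a::idom fract) = Fract (of_nat n) 1"
  by (induction n) (simp_all add: Zero_fract_def One_fract_def)

lemma of_nat_qrat_eq_0_iff: "(of_nat n :: qrat) = 0 \<longleftrightarrow> n = 0"
  by (simp add: of_nat_fract Zero_fract_def eq_fract)

lemma J_defining_equation:
  assumes "1 \<le> r" "r \<le> n"
  shows "\<phi> (p_sym n r) =
     (1 - qv) ^ (n - r) * (qv ^ (r choose 2) / (of_nat (fact r) * of_nat (fact (n - r)))) * J \<phi> n r"
proof -
  have "(of_nat (fact k) :: qrat) \<noteq> 0" for k
    unfolding of_nat_qrat_eq_0_iff by simp
  then show ?thesis
    using assms qv_neq_0 qv_neq_1 unfolding J_def by (simp del: of_nat_fact)
qed


subsection \<open>Index sets and summands\<close>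

definition compositions :: "nat \<Rightarrow> nat list set" where
  "compositions N = {u. u \<noteq> [] \<and> (\<forall>x\<in>set u. 0 < x) \<and> sum_list u = N}"

lemma finite_compositions: "finite (compositions N)"
proof (rule finite_subset)
  have "length u \<le> sum_list u" if "\<forall>x\<in>set u. 0 < x" for u :: "nat list"
    using that by (induction u) auto
  then show "compositions N \<subseteq> {u. set u \<subseteq> {..N} \<and> length u \<le> N}"
    unfolding compositions_def by (auto intro: member_le_sum_list)
  show "finite {u. set u \<subseteq> {..N} \<and> length u \<le> N}"
    by (rule finite_lists_length_le) simp
qed

definition multinomial :: "nat list \<Rightarrow> nat" where
  "multinomial u = fact (sum_list u) div (\<Prod>x\<leftarrow>u. fact x)"

text \<open>The lists are indexed from 0: the tuple entry \<open>u\<^sub>i\<close> is \<open>u ! (i - 1)\<close>.\<close>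

definition comp_term :: "nat \<Rightarrow> nat list \<Rightarrow> qrat" where
  "comp_term r u =
     q_int r ^ (u ! 0) * (\<Prod>i<length u - 1. q_int (u ! i) ^ (u ! Suc i)) *
     qv ^ (\<Sum>i<length u. (u ! i) choose 2) * of_nat (multinomial u)"

text \<open>
  For finitely supported sequences \<open>u\<close>, too, \<open>u\<^sub>i\<close> is \<open>lookup u (i - 1)\<close>; the sum of the
  sequence is \<open>mono_degree u\<close>.
  \<open>Prod_any\<close> is the product of the (finitely many) factors different from 1.
\<close>

definition seq_term :: "nat \<Rightarrow> (nat \<Rightarrow>\<^sub>0 nat) \<Rightarrow> qrat" where
  "seq_term r u =
     q_int r ^ Poly_Mapping.lookup u 0 *
     qv ^ (\<Sum>i\<in>Poly_Mapping.keys u. Poly_Mapping.lookup u i choose 2) *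
     (\<Prod>i. q_int (Poly_Mapping.lookup u i) ^ Poly_Mapping.lookup u (Suc i)
            / of_nat (fact (Poly_Mapping.lookup u i)))"

lemma finite_seq_factors:
  "finite {i. q_int (Poly_Mapping.lookup u i) ^ Poly_Mapping.lookup u (Suc i)
              / of_nat (fact (Poly_Mapping.lookup u i)) \<noteq> 1}" (is "finite ?S")
proof (rule finite_subset)
  show "?S \<subseteq> Poly_Mapping.keys u \<union> Suc -` Poly_Mapping.keys u"
  proof
    fix i assume "i \<in> ?S"
    then have "\<not> (Poly_Mapping.lookup u i = 0 \<and> Poly_Mapping.lookup u (Suc i) = 0)"
      by (intro notI, elim conjE) simp
    then show "i \<in> Poly_Mapping.keys u \<union> Suc -` Poly_Mapping.keys u"
      by (simp add: in_keys_iff)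
  qed
  show "finite (Poly_Mapping.keys u \<union> Suc -` Poly_Mapping.keys u)"
    by (simp add: finite_vimageI)
qed

text \<open>
  There are infinitely many sequences of given sum, but only finitely many nonzero summands,
  so that a sum over all sequences may be expressed by \<open>Sum_any\<close>.
\<close>

lemma finite_seq_terms: "finite {u. (if mono_degree u = N then seq_term r u else 0) \<noteq> 0}"
proof -
  have sub: "Poly_Mapping.keys u \<subseteq> {..<mono_degree u}" if "seq_term r u \<noteq> 0" for u
  proof -
    let ?g = "\<lambda>i. q_int (Poly_Mapping.lookup u i) ^ Poly_Mapping.lookup u (Suc i)
            / of_nat (fact (Poly_Mapping.lookup u i))"
    have "(\<Prod>i. ?g i) \<noteq> 0" using that unfolding seq_term_def by auto
    then have nz: "?g i \<noteq> 0" for i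
      using Prod_any_zero[OF finite_seq_factors] by blast
    have step: "i \<in> Poly_Mapping.keys u" if "Suc i \<in> Poly_Mapping.keys u" for i
      using nz[of i] that by (auto simp: in_keys_iff q_int_def intro: gr0I)
    have down: "{..i} \<subseteq> Poly_Mapping.keys u" if "i \<in> Poly_Mapping.keys u" for i
      using that
    proof (induction i)
      case (Suc i)
      then show ?case using step[of i] by (auto simp: atMost_Suc)
    qed auto
    have "i < mono_degree u" if "i \<in> Poly_Mapping.keys u" for i
    proof -
      have "Suc i = (\<Sum>j\<le>i. 1)" by simp
      also have "\<dots> \<le> (\<Sum>j\<le>i. Poly_Mapping.lookup u j)"
      proof (rule sum_mono)
        fix j assume "j \<in> {..i}"
        then have "j \<in> Poly_Mapping.keys u" using down[OF that] by blast
        then show "1 \<le> Poly_Mapping.lookup u j" by (simp add: in_keys_iff Suc_le_eq)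
      qed
      also have "\<dots> \<le> mono_degree u"
        unfolding mono_degree_def by (rule sum_mono2) (use down[OF that] in auto)
      finally show ?thesis by simp
    qed
    then show ?thesis by blast
  qed
  show ?thesis
  proof (rule finite_subset)
    show "{u. (if mono_degree u = N then seq_term r u else 0) \<noteq> 0} \<subseteq>
        {u. Poly_Mapping.keys u \<subseteq> {..<N} \<and> (\<forall>i. Poly_Mapping.lookup u i \<le> N)}"
      using sub lookup_le_mono_degree by (auto split: if_splits)
    show "finite {u::mono. Poly_Mapping.keys u \<subseteq> {..<N} \<and> (\<forall>i. Poly_Mapping.lookup u i \<le> N)}"
      by (rule finite_monos) simp
  qed
qed

end

theory Submission
  imports Defs
begin

text \<open>
  Let \<open>E(t) = \<Sum>\<^sub>n e\<^sub>n t\<^sup>n\<close>. Since \<open>\<Sum> p\<^sub>n\<^sup>(\<^sup>r\<^sup>) z\<^sup>r t\<^sup>n = E((z - 1) t) / E(-t)\<close>, applying \<open>\<phi>\<close> shows that, for fixed \<open>r\<close>,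
  the exponential generating function \<open>G\<^sub>r(t)\<close> of \<open>(1 - q)\<^sup>N J\<^sub>r\<^sub>+\<^sub>N\<^sup>(\<^sup>r\<^sup>)\<close> equals \<open>A(q\<^sup>r t) / A(t)\<close> with
  \<open>A(t) = \<Sum>\<^sub>n (-1)\<^sup>n q\<^bsup>n choose 2\<^esup> t\<^sup>n / n!\<close>. The binomial theorem gives
  \<open>A(q\<^sup>r t) = \<Sum>\<^sub>u (1 - q\<^sup>r)\<^sup>u q\<^bsup>u choose 2\<^esup> t\<^sup>u / u! A(q\<^sup>u t)\<close>; dividing by \<open>A(t)\<close> expresses \<open>G\<^sub>r\<close> through
  the \<open>G\<^sub>u\<close>. Iterating this recursion produces both sums, \<open>u\<close> being the first entry of the sequence.
\<close>

section \<open>Coefficients of the symmetric functions involved\<close>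

lemma symcoeff_sum: "symcoeff (\<Sum>i\<in>A. f i) \<alpha> = (\<Sum>i\<in>A. symcoeff (f i) \<alpha>)"
  by (induction A rule: infinite_finite_induct) (simp_all add: zero_symfun.rep_eq plus_symfun.rep_eq)

lemma shape_in_partitions_iff:
  "shape \<alpha> \<in> partitions n r \<longleftrightarrow> mono_degree \<alpha> = n \<and> card (Poly_Mapping.keys \<alpha>) = r"
  unfolding partitions_def mem_Collect_eq sum_mset_shape
  by (auto simp: shape_def in_keys_iff)

lemma symcoeff_p_sym:
  "symcoeff (p_sym n r :: 'a::comm_ring_1 symfun) \<alpha> =
     (if mono_degree \<alpha> = n \<and> card (Poly_Mapping.keys \<alpha>) = r then 1 else 0)"
proof -
  have "symcoeff (p_sym n r :: 'a symfun) \<alpha> =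
          (\<Sum>\<mu>\<in>partitions n r. if shape \<alpha> = \<mu> then 1 else 0)"
    by (simp add: p_sym_def symcoeff_sum mono_sym.rep_eq)
  also have "\<dots> = (if shape \<alpha> \<in> partitions n r then 1 else 0)"
    by (simp add: sum.delta'[OF finite_partitions])
  finally show ?thesis by (simp add: shape_in_partitions_iff)
qed

text \<open>Each variable that occurs contributes at least 1 to the degree, so a monomial in
  \<open>r\<close> variables has degree at least \<open>r\<close>. This later cuts a convolution off
  at \<open>N\<close>.\<close>

lemma p_sym_eq_0:
  assumes "n < r"
  shows "p_sym n r = 0"
proof (rule symfun_eqI)
  fix \<alpha> :: mono
  have "card (Poly_Mapping.keys \<alpha>) = (\<Sum>i\<in>Poly_Mapping.keys \<alpha>. 1)" by simp
  also have "\<dots> \<le> mono_degree \<alpha>"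
    unfolding mono_degree_def by (rule sum_mono) (simp add: in_keys_iff Suc_le_eq)
  finally show "symcoeff (p_sym n r) \<alpha> = symcoeff 0 \<alpha>"
    using assms by (simp add: symcoeff_p_sym zero_symfun.rep_eq)
qed

lemma elem_sym_0: "elem_sym 0 = 1"
proof (rule symfun_eqI)
  fix \<alpha> :: mono
  have "mono_degree \<alpha> = 0 \<Longrightarrow> \<alpha> = 0"
    using lookup_le_mono_degree[of \<alpha>] by (intro poly_mapping_eqI) auto
  then show "symcoeff (elem_sym 0) \<alpha> = symcoeff 1 \<alpha>"
    by (auto simp: elem_sym.rep_eq one_symfun.rep_eq)
qed

section \<open>The convolution identity between elementary symmetric functions and
  \<open>p_sym\<close>\<close>

lemma sum_Pow_insert:
  fixes f :: "'a set \<Rightarrow> 'b::comm_monoid_add"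
  assumes "finite A" "x \<notin> A"
  shows "(\<Sum>S\<in>Pow (insert x A). f S) = (\<Sum>S\<in>Pow A. f S + f (insert x S))"
proof -
  have "(\<Sum>S\<in>Pow (insert x A). f S) = (\<Sum>S\<in>Pow A. f S) + (\<Sum>S\<in>insert x ` Pow A. f S)"
    unfolding Pow_insert by (rule sum.union_disjoint) (use assms in auto)
  also have "(\<Sum>S\<in>insert x ` Pow A. f S) = (\<Sum>S\<in>Pow A. f (insert x S))"
    by (rule sum.reindex_cong[of "insert x"]) (use assms in \<open>auto intro!: inj_onI\<close>)
  finally show ?thesis by (simp add: sum.distrib)
qed

text \<open>If some \<open>v\<close> in \<open>K\<close> lies outside \<open>U\<close>, adding
  \<open>v\<close> to \<open>S\<close> keeps \<open>S \<inter> U\<close> and flips the sign, so the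
  terms cancel in pairs. If \<open>U = K\<close>, the condition fixes \<open>card S\<close> as
  \<open>card K - r\<close>, so all surviving terms have the same sign and are counted by a binomial
  coefficient.\<close>

lemma alternating_subset_sum:
  fixes K U :: "'b set"
  assumes "finite K" "U \<subseteq> K"
  shows "(\<Sum>S\<in>Pow K. if card (K - S \<inter> U) = r then (- 1) ^ card S else 0) =
     (if U = K then (- 1) ^ (card K - r) * of_nat (card K choose r) else (0::'a::comm_ring_1))"
proof (cases "U = K")
  case True
  have diff: "card (K - S \<inter> K) = card K - card S" if "S \<in> Pow K" for S
    using that assms by (simp add: Int_absorb2 card_Diff_subset finite_subset)
  show ?thesis
  proof (cases "r \<le> card K")
    case le: True
    have "(\<Sum>S\<in>Pow K. if card (K - S \<inter> U) = r then (- 1) ^ card S else (0::'a)) =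
          (\<Sum>S\<in>{S. S \<subseteq> K \<and> card S = card K - r}. (- 1) ^ (card K - r))"
    proof (rule sum.mono_neutral_cong_right)
      have "card (K - S \<inter> K) = r \<longleftrightarrow> card S = card K - r" if "S \<in> Pow K" for S
        using diff[OF that] card_mono[OF assms(1), of S] that le by auto
      then show "\<forall>S\<in>Pow K - {S. S \<subseteq> K \<and> card S = card K - r}.
          (if card (K - S \<inter> U) = r then (- 1) ^ card S else (0::'a)) = 0"
        and "\<And>S. S \<in> {S. S \<subseteq> K \<and> card S = card K - r} \<Longrightarrow>
          (if card (K - S \<inter> U) = r then (- 1) ^ card S else (0::'a)) = (- 1) ^ (card K - r)"
        unfolding True by simp_all
    qed (use assms in auto)
    also have "\<dots> = (- 1) ^ (card K - r) * of_nat (card K choose r)"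
      using n_subsets[OF assms(1), of "card K - r"] binomial_symmetric[OF le]
      by (simp add: mult.commute)
    finally show ?thesis by (simp only: True simp_thms if_True)
  next
    case False
    \<comment> \<open>For \<open>r > card K\<close> no \<open>S\<close> meets the condition, and the
      binomial coefficient vanishes too.\<close>
    then show ?thesis using True by (auto simp: diff binomial_eq_0 intro!: sum.neutral)
  qed
next
  case False
  then obtain v where v: "v \<in> K" "v \<notin> U" using assms by blast
  define A where "A = K - {v}"
  have A: "finite A" "v \<notin> A" "K = insert v A" using assms v by (auto simp: A_def)
  have "(if card (K - S \<inter> U) = r then (- 1) ^ card S else 0) +
      (if card (K - insert v S \<inter> U) = r then (- 1) ^ card (insert v S) else 0) = (0::'a)"
    if "S \<in> Pow A" for S
  proof -
    have "finite S" "v \<notin> S" using that A finite_subset[of S A] by auto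
    moreover have "insert v S \<inter> U = S \<inter> U" using v by auto
    ultimately show ?thesis by simp
  qed
  then have "(\<Sum>S\<in>Pow (insert v A). if card (K - S \<inter> U) = r then (- 1) ^ card S else 0) = (0::'a)"
    unfolding sum_Pow_insert[OF A(1,2)] by (rule sum.neutral[OF ballI])
  then show ?thesis using False by (simp only: A(3)[symmetric] if_False)
qed

text \<open>The squarefree monomial with variable set \<open>S\<close>. The test
  \<open>finite S\<close> gives every argument finite support, as the type demands.\<close>

lift_definition indicator_mono :: "nat set \<Rightarrow> mono" is
  "\<lambda>S i. if finite S \<and> i \<in> S then 1 else 0"
  by simp

lemma keys_indicator_mono: "finite S \<Longrightarrow> Poly_Mapping.keys (indicator_mono S) = S"
  by (auto simp: in_keys_iff indicator_mono.rep_eq split: if_splits)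

lemma lookup_indicator_mono:
  "finite S \<Longrightarrow> Poly_Mapping.lookup (indicator_mono S) i = (if i \<in> S then 1 else 0)"
  by (simp add: indicator_mono.rep_eq)

lemma mono_degree_indicator_mono: "finite S \<Longrightarrow> mono_degree (indicator_mono S) = card S"
  by (simp add: mono_degree_def keys_indicator_mono lookup_indicator_mono)

lemma indicator_mono_keys:
  assumes "\<forall>i. Poly_Mapping.lookup \<alpha> i \<le> 1"
  shows "indicator_mono (Poly_Mapping.keys \<alpha>) = \<alpha>"
proof (rule poly_mapping_eqI)
  fix i
  show "Poly_Mapping.lookup (indicator_mono (Poly_Mapping.keys \<alpha>)) i = Poly_Mapping.lookup \<alpha> i"
    using spec[OF assms, of i] by (auto simp: lookup_indicator_mono in_keys_iff le_Suc_eq)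
qed

text \<open>A squarefree divisor \<open>\<alpha>\<close> of \<open>\<gamma>\<close> is determined by
  its variable set \<open>S\<close>, an arbitrary subset of \<open>K\<close>. A variable of
  \<open>\<gamma>\<close> is missing from the cofactor exactly when it lies in \<open>S\<close> and
  has exponent 1 in \<open>\<gamma>\<close>.\<close>

lemma squarefree_split_sum:
  fixes \<gamma> :: mono
  defines "K \<equiv> Poly_Mapping.keys \<gamma>"
  shows "(\<Sum>(\<alpha>, \<beta>) | \<alpha> + \<beta> = \<gamma>.
            if (\<forall>i. Poly_Mapping.lookup \<alpha> i \<le> 1) \<and> card (Poly_Mapping.keys \<beta>) = r
            then (- 1) ^ mono_degree \<alpha> else (0::'a::comm_ring_1)) =
     (\<Sum>S\<in>Pow K. if card (K - S \<inter> {i. Poly_Mapping.lookup \<gamma> i = 1}) = r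
                    then (- 1) ^ card S else 0)"
    (is "?L = ?R")
proof -
  let ?sqf = "\<lambda>\<alpha>::mono. \<forall>i. Poly_Mapping.lookup \<alpha> i \<le> 1"
  have fin: "finite S" if "S \<in> Pow K" for S
    using that finite_subset[of S K] unfolding K_def by auto
  have split: "indicator_mono S + (\<gamma> - indicator_mono S) = \<gamma>" if "S \<in> Pow K" for S
    using that fin[OF that]
    by (intro poly_mapping_eqI) (auto simp: lookup_add lookup_minus lookup_indicator_mono K_def in_keys_iff)
  have keys: "Poly_Mapping.keys (\<gamma> - indicator_mono S) = K - S \<inter> {i. Poly_Mapping.lookup \<gamma> i = 1}"
    if "S \<in> Pow K" for S
    using that fin[OF that]
    by (auto simp: lookup_minus lookup_indicator_mono K_def in_keys_iff split: if_splits)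
  have "?L = (\<Sum>(\<alpha>, \<beta>) | \<alpha> + \<beta> = \<gamma> \<and> ?sqf \<alpha>.
            if card (Poly_Mapping.keys \<beta>) = r then (- 1) ^ mono_degree \<alpha> else 0)"
    by (rule sum.mono_neutral_cong_right[OF finite_add_eq]) (auto split: if_splits)
  also have "\<dots> = ?R"
  proof (rule sum.reindex_bij_witness[of _
        "\<lambda>S. (indicator_mono S, \<gamma> - indicator_mono S)" "\<lambda>(\<alpha>, \<beta>). Poly_Mapping.keys \<alpha>"])
    fix p assume "p \<in> {(\<alpha>, \<beta>). \<alpha> + \<beta> = \<gamma> \<and> ?sqf \<alpha>}"
    then obtain \<alpha> \<beta> where p: "p = (\<alpha>, \<beta>)" "\<alpha> + \<beta> = \<gamma>" "?sqf \<alpha>" by auto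
    have sub: "Poly_Mapping.keys \<alpha> \<in> Pow K"
      using p(2) by (auto simp: K_def in_keys_iff lookup_add)
    have ind: "indicator_mono (Poly_Mapping.keys \<alpha>) = \<alpha>"
      by (rule indicator_mono_keys[OF p(3)])
    have \<beta>: "\<gamma> - \<alpha> = \<beta>" using p(2) by auto
    show "(case p of (\<alpha>, \<beta>) \<Rightarrow> Poly_Mapping.keys \<alpha>) \<in> Pow K" using sub p by simp
    show "(indicator_mono (case p of (\<alpha>, \<beta>) \<Rightarrow> Poly_Mapping.keys \<alpha>),
           \<gamma> - indicator_mono (case p of (\<alpha>, \<beta>) \<Rightarrow> Poly_Mapping.keys \<alpha>)) = p"
      using ind \<beta> p by simp
    have "mono_degree \<alpha> = card (Poly_Mapping.keys \<alpha>)"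
      using mono_degree_indicator_mono[OF finite_keys, of \<alpha>] ind by simp
    then show "(if card (K - (case p of (\<alpha>, \<beta>) \<Rightarrow> Poly_Mapping.keys \<alpha>) \<inter>
                 {i. Poly_Mapping.lookup \<gamma> i = 1}) = r
          then (- 1) ^ card (case p of (\<alpha>, \<beta>) \<Rightarrow> Poly_Mapping.keys \<alpha>) else 0) =
        (case p of (\<alpha>, \<beta>) \<Rightarrow> if card (Poly_Mapping.keys \<beta>) = r then (- 1) ^ mono_degree \<alpha>
          else (0::'a))"
      using keys[OF sub] ind \<beta> p(1) by simp
  next
    fix S assume "S \<in> Pow K"
    then show "(case (indicator_mono S, \<gamma> - indicator_mono S) of (\<alpha>, \<beta>) \<Rightarrow> Poly_Mapping.keys \<alpha>) = S"
      and "(indicator_mono S, \<gamma> - indicator_mono S) \<in> {(\<alpha>, \<beta>). \<alpha> + \<beta> = \<gamma> \<and> ?sqf \<alpha>}"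
      using split fin by (auto simp: keys_indicator_mono lookup_indicator_mono)
  qed
  finally show ?thesis .
qed

text \<open>
  This is the coefficient of \<open>z\<^sup>r t\<^sup>n\<close> in \<open>E(-t) \<Prod>\<^sub>i (1 + z x\<^sub>i t / (1 - x\<^sub>i t)) = E((z - 1) t)\<close>,
  where \<open>E(t) = \<Prod>\<^sub>i (1 + x\<^sub>i t)\<close>.
\<close>

lemma elem_sym_p_sym:
  "(\<Sum>j\<le>n. sym_scale ((- 1) ^ j) (elem_sym j * p_sym (n - j) r)) =
     sym_scale ((- 1) ^ (n - r) * of_nat (n choose r)) (elem_sym n :: 'a::comm_ring_1 symfun)"
proof (rule symfun_eqI)
  fix \<gamma> :: mono
  let ?sqf = "\<lambda>\<alpha>::mono. \<forall>i. Poly_Mapping.lookup \<alpha> i \<le> 1"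
  let ?K = "Poly_Mapping.keys \<gamma>"
  \<comment> \<open>For a fixed factorization only \<open>j = mono_degree \<alpha>\<close> can
    contribute, so the sum over \<open>j\<close> collapses.\<close>
  have inner: "(\<Sum>j\<le>n. (- 1) ^ j * (symcoeff (elem_sym j) \<alpha> * symcoeff (p_sym (n - j) r) \<beta>)) =
      (if mono_degree \<gamma> = n then
        (if ?sqf \<alpha> \<and> card (Poly_Mapping.keys \<beta>) = r then (- 1) ^ mono_degree \<alpha> else (0::'a))
       else 0)" if "\<alpha> + \<beta> = \<gamma>" for \<alpha> \<beta>
  proof -
    have d: "mono_degree \<gamma> = mono_degree \<alpha> + mono_degree \<beta>"
      using that mono_degree_add by blast
    have "(\<Sum>j\<le>n. (- 1) ^ j * (symcoeff (elem_sym j) \<alpha> * symcoeff (p_sym (n - j) r) \<beta>)) =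
       (\<Sum>j\<le>n. if j = mono_degree \<alpha> then
          (if ?sqf \<alpha> \<and> card (Poly_Mapping.keys \<beta>) = r \<and> mono_degree \<gamma> = n
           then (- 1) ^ mono_degree \<alpha> else (0::'a)) else 0)"
      by (rule sum.cong) (auto simp: elem_sym.rep_eq symcoeff_p_sym d)
    then show ?thesis using d by (auto simp: sum.delta)
  qed
  have "symcoeff (\<Sum>j\<le>n. sym_scale ((- 1) ^ j) (elem_sym j * p_sym (n - j) r)) \<gamma> =
      (\<Sum>j\<le>n. \<Sum>(\<alpha>, \<beta>) | \<alpha> + \<beta> = \<gamma>.
         (- 1) ^ j * (symcoeff (elem_sym j) \<alpha> * symcoeff (p_sym (n - j) r) \<beta>))"
    by (simp add: symcoeff_sum sym_scale.rep_eq times_symfun.rep_eq conv_def sum_distrib_left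
        case_prod_unfold)
  also have "\<dots> = (\<Sum>(\<alpha>, \<beta>) | \<alpha> + \<beta> = \<gamma>. \<Sum>j\<le>n.
         (- 1) ^ j * (symcoeff (elem_sym j) \<alpha> * symcoeff (p_sym (n - j) r) \<beta>))"
    by (subst sum.swap) (simp add: case_prod_unfold)
  also have "\<dots> = (\<Sum>(\<alpha>, \<beta>) | \<alpha> + \<beta> = \<gamma>. if mono_degree \<gamma> = n then
        (if ?sqf \<alpha> \<and> card (Poly_Mapping.keys \<beta>) = r then (- 1) ^ mono_degree \<alpha> else (0::'a))
       else 0)"
    by (rule sum.cong) (use inner in auto)
  also have "\<dots> = (if mono_degree \<gamma> = n then
      (\<Sum>(\<alpha>, \<beta>) | \<alpha> + \<beta> = \<gamma>.
        if ?sqf \<alpha> \<and> card (Poly_Mapping.keys \<beta>) = r then (- 1) ^ mono_degree \<alpha> else (0::'a))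
       else 0)"
    by simp
  \<comment> \<open>The set of variables of exponent 1 is cut down to \<open>?K\<close> to serve as
    \<open>U\<close> in \<open>alternating_subset_sum\<close>; it is all of \<open>?K\<close>
    exactly when \<open>\<gamma>\<close> is squarefree.\<close>
  also have "\<dots> = (if mono_degree \<gamma> = n then
      (\<Sum>S\<in>Pow ?K. if card (?K - S \<inter> (?K \<inter> {i. Poly_Mapping.lookup \<gamma> i = 1})) = r
         then (- 1) ^ card S else 0) else 0)"
    unfolding squarefree_split_sum
    by (auto intro!: sum.cong simp: Int_assoc[symmetric] Int_absorb2)
  also have "\<dots> = (if mono_degree \<gamma> = n \<and> ?sqf \<gamma> then (- 1) ^ (n - r) * of_nat (n choose r) else 0)"
  proof -
    have iff: "?K \<inter> {i. Poly_Mapping.lookup \<gamma> i = 1} = ?K \<longleftrightarrow> ?sqf \<gamma>"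
      by (simp add: set_eq_iff in_keys_iff le_eq_less_or_eq) (metis neq0_conv)
    have "card ?K = mono_degree \<gamma>" if "?sqf \<gamma>"
      using mono_degree_indicator_mono[OF finite_keys, of \<gamma>] indicator_mono_keys[OF that] by simp
    then show ?thesis
      by (subst alternating_subset_sum, simp, simp, unfold iff) auto
  qed
  also have "\<dots> = symcoeff (sym_scale ((- 1) ^ (n - r) * of_nat (n choose r)) (elem_sym n)) \<gamma>"
    by (auto simp: sym_scale.rep_eq elem_sym.rep_eq)
  finally show "symcoeff (\<Sum>j\<le>n. sym_scale ((- 1) ^ j) (elem_sym j * p_sym (n - j) r)) \<gamma> =
      symcoeff (sym_scale ((- 1) ^ (n - r) * of_nat (n choose r)) (elem_sym n :: 'a symfun)) \<gamma>" .
qed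


section \<open>Power series coefficients and the abstract recursion\<close>

lemma qrat_fact_neq_0 [simp]: "(of_nat (fact n) :: qrat) \<noteq> 0"
  unfolding of_nat_qrat_eq_0_iff by simp

lemma one_minus_qv_power: "1 - qv ^ r = (1 - qv) * q_int r"
  by (simp add: q_int_def one_diff_power_eq)

text \<open>The cross term \<open>m * n\<close> is the source of the factors
  \<open>qv ^ (u * (N - u))\<close> and \<open>qv ^ (r * N)\<close> below.\<close>

lemma choose_two_add: "(m + n) choose 2 = (m choose 2) + (n choose 2) + m * n"
proof (induction m)
  case (Suc m)
  then show ?case by (simp add: numeral_2_eq_2 algebra_simps)
qed simp

lemma of_nat_binomial_div_fact:
  assumes "k \<le> n"
  shows "of_nat (n choose k) / of_nat (fact n) = (1 / (of_nat (fact k) * of_nat (fact (n - k))) :: qrat)"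
proof -
  have "of_nat (fact k) * of_nat (fact (n - k)) * of_nat (n choose k) = (of_nat (fact n) :: qrat)"
    unfolding of_nat_mult[symmetric] binomial_fact_lemma[OF assms] ..
  then show ?thesis by (simp add: divide_simps mult_ac del: of_nat_mult of_nat_fact)
qed

text \<open>This is \<open>(- 1) ^ n\<close> times the prescribed value of \<open>\<phi>\<close> at
  \<open>elem_sym n\<close>, hence the coefficient of \<open>t ^ n\<close> in the image of
  \<open>E(-t)\<close>.\<close>

definition euler_coeff :: "nat \<Rightarrow> qrat" where
  "euler_coeff n = (- 1) ^ n * qv ^ (n choose 2) / of_nat (fact n)"

text \<open>Up to a factor \<open>(1 - qv) ^ u\<close>, the contribution of an entry
  \<open>u\<close> that follows an entry \<open>r\<close> in the final sums.\<close>

definition jump_coeff :: "nat \<Rightarrow> nat \<Rightarrow> qrat" where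
  "jump_coeff r u = (1 - qv ^ r) ^ u * qv ^ (u choose 2) / of_nat (fact u)"

text \<open>
  With \<open>A(t) = \<Sum>\<^sub>n euler_coeff n t\<^sup>n\<close>, this is the coefficient of \<open>t\<^sup>N\<close> in
  \<open>A(q\<^sup>r t) = \<Sum>\<^sub>u jump_coeff r u t\<^sup>u A(q\<^sup>u t)\<close>; it is the binomial expansion of
  \<open>(-q\<^sup>r)\<^sup>N = ((1 - q\<^sup>r) - 1)\<^sup>N\<close>.
\<close>

lemma euler_coeff_shift:
  "(\<Sum>u\<le>N. jump_coeff r u * (euler_coeff (N - u) * qv ^ (u * (N - u)))) = euler_coeff N * qv ^ (r * N)"
proof -
  have "jump_coeff r u * (euler_coeff (N - u) * qv ^ (u * (N - u))) =
      qv ^ (N choose 2) / of_nat (fact N) * (of_nat (N choose u) * (1 - qv ^ r) ^ u * (- 1) ^ (N - u))"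
    if "u \<le> N" for u
  proof -
    have "qv ^ (N choose 2) = qv ^ (u choose 2) * qv ^ ((N - u) choose 2) * qv ^ (u * (N - u))"
      using choose_two_add[of u "N - u"] that by (simp add: power_add)
    then have "jump_coeff r u * (euler_coeff (N - u) * qv ^ (u * (N - u))) =
        (1 - qv ^ r) ^ u * (- 1) ^ (N - u) * qv ^ (N choose 2) *
        (1 / (of_nat (fact u) * of_nat (fact (N - u))))"
      by (simp add: jump_coeff_def euler_coeff_def mult_ac del: of_nat_fact)
    then show ?thesis
      by (simp add: of_nat_binomial_div_fact[OF that, symmetric] mult_ac del: of_nat_fact)
  qed
  then have "(\<Sum>u\<le>N. jump_coeff r u * (euler_coeff (N - u) * qv ^ (u * (N - u)))) =
      qv ^ (N choose 2) / of_nat (fact N) * ((1 - qv ^ r) + (- 1)) ^ N"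
    unfolding binomial_ring sum_distrib_left by (intro sum.cong) auto
  also have "((1 - qv ^ r) + (- 1)) ^ N = (- 1) ^ N * qv ^ (r * N)"
    by (simp add: power_mult power_minus[of "qv ^ r"])
  finally show ?thesis by (simp add: euler_coeff_def mult_ac)
qed

text \<open>Formal power series over an integral domain have no zero divisors, so the nonzero series
  with coefficients \<open>a\<close> can be cancelled.\<close>

lemma convolution_unique:
  fixes a x y :: "nat \<Rightarrow> 'a::idom"
  assumes "a 0 \<noteq> 0" "\<And>N. (\<Sum>j\<le>N. a j * x (N - j)) = (\<Sum>j\<le>N. a j * y (N - j))"
  shows "x = y"
proof -
  have "Abs_fps a * Abs_fps x = Abs_fps a * Abs_fps y"
    using assms(2) by (intro fps_ext) (simp add: fps_mult_nth atLeast0AtMost)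
  moreover have "Abs_fps a \<noteq> 0" using assms(1) by (metis fps_nth_Abs_fps fps_zero_nth)
  ultimately have "Abs_fps x = Abs_fps y" by (metis mult_left_cancel)
  then show ?thesis by (simp add: fps_eq_iff fun_eq_iff)
qed

text \<open>With \<open>H_r(t)\<close> the series of \<open>h N r\<close>, the hypothesis reads
  \<open>A(t) H_r(t) = A(q^r t)\<close>. Multiplying the claimed right-hand side by
  \<open>A(t)\<close> turns each \<open>H_u(t)\<close> into \<open>A(q^u t)\<close>, and
  \<open>euler_coeff_shift\<close> sums these to \<open>A(q^r t)\<close> as well; then
  \<open>A(t)\<close> is cancelled.\<close>

lemma jump_recursion:
  fixes h :: "nat \<Rightarrow> nat \<Rightarrow> qrat"
  assumes "\<And>N r. (\<Sum>j\<le>N. euler_coeff j * h (N - j) r) = euler_coeff N * qv ^ (r * N)"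
  shows "h N r = (\<Sum>u\<le>N. jump_coeff r u * h (N - u) u)"
proof -
  have rhs: "(\<Sum>j\<le>N. euler_coeff j * (\<Sum>u\<le>N - j. jump_coeff r u * h (N - j - u) u)) =
        euler_coeff N * qv ^ (r * N)" for N
  proof -
    have "(\<Sum>j\<le>N. euler_coeff j * (\<Sum>u\<le>N - j. jump_coeff r u * h (N - j - u) u)) =
        (\<Sum>(j, u)\<in>(SIGMA j:{..N}. {..N - j}). euler_coeff j * (jump_coeff r u * h (N - j - u) u))"
      unfolding sum_distrib_left by (rule sum.Sigma) auto
    also have "\<dots> =
        (\<Sum>(u, j)\<in>(SIGMA u:{..N}. {..N - u}). jump_coeff r u * (euler_coeff j * h (N - u - j) u))"
      by (rule sum.reindex_bij_witness[of _ prod.swap prod.swap])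
         (auto simp: mult_ac add.commute)
    also have "\<dots> = (\<Sum>u\<le>N. jump_coeff r u * (\<Sum>j\<le>N - u. euler_coeff j * h (N - u - j) u))"
      unfolding sum_distrib_left by (rule sum.Sigma[symmetric]) auto
    finally show ?thesis by (simp only: assms euler_coeff_shift)
  qed
  have "(\<lambda>N. h N r) = (\<lambda>N. \<Sum>u\<le>N. jump_coeff r u * h (N - u) u)"
  proof (rule convolution_unique)
    show "euler_coeff 0 \<noteq> 0" by (simp add: euler_coeff_def binomial_eq_0)
    show "(\<Sum>j\<le>N. euler_coeff j * h (N - j) r) =
        (\<Sum>j\<le>N. euler_coeff j * (\<Sum>u\<le>N - j. jump_coeff r u * h (N - j - u) u))" for N
      by (simp only: assms rhs)
  qed
  then show ?thesis by meson
qed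

section \<open>The specialization and the recursion for \<open>J\<close>\<close>

lemma alg_hom_sum:
  assumes "alg_hom \<phi>"
  shows "\<phi> (\<Sum>i\<in>A. f i) = (\<Sum>i\<in>A. \<phi> (f i))"
proof -
  have add: "\<phi> (x + y) = \<phi> x + \<phi> y" for x y using assms by (simp add: alg_hom_def)
  have "\<phi> 0 = 0" using add[of 0 0] by simp
  then show ?thesis by (induction A rule: infinite_finite_induct) (simp_all add: add)
qed

locale q_exponential_specialization =
  fixes \<phi> :: "qrat symfun \<Rightarrow> qrat"
  assumes alg_hom: "alg_hom \<phi>"
    and elem_sym_value: "\<And>n. n \<ge> 1 \<Longrightarrow> \<phi> (elem_sym n) = qv ^ (n choose 2) / of_nat (fact n)"
begin

lemma elem_sym_value': "\<phi> (elem_sym n) = qv ^ (n choose 2) / of_nat (fact n)"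
  using alg_hom elem_sym_value[of n]
  by (cases "n = 0") (simp_all add: elem_sym_0 alg_hom_def binomial_eq_0)

text \<open>The image under \<open>\<phi>\<close> of \<open>elem_sym_p_sym\<close> in degree
  \<open>r + N\<close>; the terms with \<open>j > N\<close> vanish because there the degree of
  \<open>p_sym\<close> is below \<open>r\<close>.\<close>

lemma p_sym_value_convolution:
  "(\<Sum>j\<le>N. euler_coeff j * \<phi> (p_sym (r + (N - j)) r)) =
     qv ^ (r choose 2) / of_nat (fact r) * (euler_coeff N * qv ^ (r * N))"
proof -
  have scale: "\<phi> (sym_scale c f) = c * \<phi> f" and mult: "\<phi> (f * g) = \<phi> f * \<phi> g" for c f g
    using alg_hom by (simp_all add: alg_hom_def)
  have z: "\<phi> 0 = 0" using alg_hom_sum[OF alg_hom, of _ "{}"] by simp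
  have "(\<Sum>j\<le>N. euler_coeff j * \<phi> (p_sym (r + (N - j)) r)) =
        (\<Sum>j\<le>r + N. euler_coeff j * \<phi> (p_sym (r + N - j) r))"
    by (rule sum.mono_neutral_cong_left) (auto simp: p_sym_eq_0 z)
  also have "\<dots> = \<phi> (\<Sum>j\<le>r + N. sym_scale ((- 1) ^ j) (elem_sym j * p_sym (r + N - j) r))"
    by (simp add: alg_hom_sum[OF alg_hom] scale mult elem_sym_value' euler_coeff_def mult_ac)
  also have "\<dots> = (- 1) ^ N * qv ^ ((r + N) choose 2) *
      (of_nat ((r + N) choose r) / of_nat (fact (r + N)))"
    by (simp add: elem_sym_p_sym scale elem_sym_value')
  also have "\<dots> = qv ^ (r choose 2) / of_nat (fact r) * (euler_coeff N * qv ^ (r * N))"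
    by (simp add: of_nat_binomial_div_fact choose_two_add power_add euler_coeff_def mult_ac
        del: of_nat_fact)
  finally show ?thesis .
qed

lemma J_recursion:
  "J \<phi> (r + N) r / of_nat (fact N) =
     (\<Sum>u\<le>N. q_int r ^ u * qv ^ (u choose 2) / of_nat (fact u) *
               (J \<phi> (u + (N - u)) u / of_nat (fact (N - u))))"
proof -
  \<comment> \<open>For \<open>r > 0\<close> this is \<open>\<phi> (p_sym (r + N) r)\<close> divided
    by \<open>qv ^ (r choose 2) / of_nat (fact r)\<close>, a normalization that makes the right-hand
    side of the convolution \<open>A(q^r t)\<close>.\<close>
  define h where "h N r = (1 - qv) ^ N * (J \<phi> (r + N) r / of_nat (fact N))" for N r
  have "(\<Sum>j\<le>N. euler_coeff j * h (N - j) r) = euler_coeff N * qv ^ (r * N)" for N r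
  proof (cases "r = 0")
    case True
    \<comment> \<open>By the convention for \<open>J\<close> at \<open>r = 0\<close>,
      \<open>h M 0\<close> is 1 for \<open>M = 0\<close> and 0 otherwise, so only
      \<open>j = N\<close> survives.\<close>
    have "(\<Sum>j\<le>N. euler_coeff j * h (N - j) r) = (\<Sum>j\<in>{N}. euler_coeff j)"
      by (rule sum.mono_neutral_cong_right) (auto simp: h_def J_def True)
    then show ?thesis by (simp add: True)
  next
    case False
    have val: "\<phi> (p_sym (r + M) r) = qv ^ (r choose 2) / of_nat (fact r) * h M r" for M
      using False by (subst J_defining_equation) (simp_all add: h_def mult_ac del: of_nat_fact)
    have "qv ^ (r choose 2) / of_nat (fact r) * (\<Sum>j\<le>N. euler_coeff j * h (N - j) r) =
        (\<Sum>j\<le>N. euler_coeff j * \<phi> (p_sym (r + (N - j)) r))"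
      unfolding val sum_distrib_left by (intro sum.cong refl mult.left_commute)
    also have "\<dots> = qv ^ (r choose 2) / of_nat (fact r) * (euler_coeff N * qv ^ (r * N))"
      by (rule p_sym_value_convolution)
    finally show ?thesis
      using qv_neq_0 by (subst (asm) mult_left_cancel) (simp_all del: of_nat_fact)
  qed
  then have "h N r = (\<Sum>u\<le>N. jump_coeff r u * h (N - u) u)"
    by (rule jump_recursion)
  \<comment> \<open>\<open>jump_coeff\<close> carries \<open>(1 - qv) ^ u\<close> and
    \<open>h\<close> carries \<open>(1 - qv) ^ (N - u)\<close>, so every term has the same power of
    \<open>1 - qv\<close>, which cancels at the end.\<close>
  also have "\<dots> = (\<Sum>u\<le>N. (1 - qv) ^ N * (q_int r ^ u * qv ^ (u choose 2) / of_nat (fact u) *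
               (J \<phi> (u + (N - u)) u / of_nat (fact (N - u)))))"
  proof (rule sum.cong)
    fix u assume "u \<in> {..N}"
    then have "(1 - qv) ^ N = (1 - qv) ^ u * (1 - qv) ^ (N - u)"
      by (simp add: power_add[symmetric])
    then show "jump_coeff r u * h (N - u) u =
        (1 - qv) ^ N * (q_int r ^ u * qv ^ (u choose 2) / of_nat (fact u) *
               (J \<phi> (u + (N - u)) u / of_nat (fact (N - u))))"
      by (simp add: jump_coeff_def h_def one_minus_qv_power power_mult_distrib mult_ac del: of_nat_fact)
  qed simp
  finally have eq: "h N r = (1 - qv) ^ N * (\<Sum>u\<le>N. q_int r ^ u * qv ^ (u choose 2) / of_nat (fact u) *
               (J \<phi> (u + (N - u)) u / of_nat (fact (N - u))))"
    unfolding sum_distrib_left .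
  have "(1 - qv) ^ N \<noteq> 0" using qv_neq_1 by simp
  from eq[unfolded h_def mult_left_cancel[OF this]] show ?thesis .
qed

end

section \<open>Unrolling the recursion over lists of positive integers\<close>

text \<open>The common form of both kinds of summand, without the factor \<open>(n - r)!\<close>.
  The first argument is the entry preceding the list.\<close>

fun path_weight :: "nat \<Rightarrow> nat list \<Rightarrow> qrat" where
  "path_weight r [] = 1"
| "path_weight r (x # xs) = q_int r ^ x * qv ^ (x choose 2) / of_nat (fact x) * path_weight x xs"

text \<open>Unlike \<open>compositions\<close>, this admits the empty list, at which the unrolling
  stops and which accounts for the case \<open>n = r\<close>.\<close>

definition positive_lists :: "nat \<Rightarrow> nat list set" where
  "positive_lists N = {u. (\<forall>x\<in>set u. 0 < x) \<and> sum_list u = N}"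

lemma positive_lists_0 [simp]: "positive_lists 0 = {[]}"
  by (auto simp: positive_lists_def) (metis list.set_intros(1) less_irrefl neq_Nil_conv)

lemma compositions_eq: "N > 0 \<Longrightarrow> compositions N = positive_lists N"
  by (auto simp: compositions_def positive_lists_def)

lemma finite_positive_lists: "finite (positive_lists N)"
  using finite_compositions[of N] by (cases "N = 0") (auto simp: compositions_eq)

lemma positive_lists_Cons:
  assumes "N > 0"
  shows "positive_lists N = (\<lambda>(x, xs). x # xs) ` (SIGMA x:{1..N}. positive_lists (N - x))"
proof (rule set_eqI)
  fix u
  show "u \<in> positive_lists N \<longleftrightarrow> u \<in> (\<lambda>(x, xs). x # xs) ` (SIGMA x:{1..N}. positive_lists (N - x))"
    using assms by (cases u) (auto simp: positive_lists_def image_iff)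
qed

lemma sum_path_weight_Cons:
  assumes "N > 0"
  shows "(\<Sum>u\<in>positive_lists N. path_weight r u) =
    (\<Sum>x=1..N. q_int r ^ x * qv ^ (x choose 2) / of_nat (fact x) *
       (\<Sum>u\<in>positive_lists (N - x). path_weight x u))"
proof -
  have "(\<Sum>u\<in>positive_lists N. path_weight r u) =
      (\<Sum>(x, u)\<in>(SIGMA x:{1..N}. positive_lists (N - x)). path_weight r (x # u))"
    unfolding positive_lists_Cons[OF assms]
    by (subst sum.reindex) (auto intro!: inj_onI simp: case_prod_unfold)
  also have "\<dots> = (\<Sum>x=1..N. \<Sum>u\<in>positive_lists (N - x). path_weight r (x # u))"
    by (rule sum.Sigma[symmetric]) (auto simp: finite_positive_lists)
  finally show ?thesis by (simp add: sum_distrib_left)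
qed

lemma (in q_exponential_specialization) J_eq_sum_path_weight:
  "J \<phi> (r + N) r / of_nat (fact N) = (\<Sum>u\<in>positive_lists N. path_weight r u)"
proof (induction N arbitrary: r rule: less_induct)
  case (less N)
  show ?case
  proof (cases "N = 0")
    case True
    \<comment> \<open>For \<open>N = 0\<close> the recursion reduces to
      \<open>J \<phi> r r = J \<phi> 0 0\<close>, which is 1.\<close>
    then show ?thesis using J_recursion[of r 0] by (simp add: J_def binomial_eq_0)
  next
    case False
    have "J \<phi> (r + N) r / of_nat (fact N) =
      (\<Sum>u\<le>N. q_int r ^ u * qv ^ (u choose 2) / of_nat (fact u) *
               (J \<phi> (u + (N - u)) u / of_nat (fact (N - u))))"
      by (rule J_recursion)
    also have "\<dots> = (\<Sum>u=1..N. q_int r ^ u * qv ^ (u choose 2) / of_nat (fact u) *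
               (\<Sum>v\<in>positive_lists (N - u). path_weight u v))"
      \<comment> \<open>The term \<open>u = 0\<close> contains \<open>J \<phi> N 0\<close>, which is
        0 since \<open>N > 0\<close>; for \<open>u \<ge> 1\<close> the induction hypothesis applies
        to \<open>N - u\<close>.\<close>
      by (rule sum.mono_neutral_cong_right)
         (use False in \<open>auto simp: J_def less.IH[symmetric] simp del: of_nat_fact\<close>)
    finally show ?thesis using False by (simp only: sum_path_weight_Cons neq0_conv)
  qed
qed

section \<open>Summands indexed by compositions\<close>

text \<open>This makes the \<open>div\<close> in \<open>multinomial\<close> an exact
  quotient.\<close>

lemma prod_list_fact_dvd: "(\<Prod>x\<leftarrow>u. fact x) dvd (fact (sum_list u) :: nat)"
proof (induction u)
  case (Cons x u)
  then have "fact x * (\<Prod>x\<leftarrow>u. fact x) dvd (fact x * fact (sum_list u) :: nat)"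
    by simp
  also have "\<dots> dvd fact (x + sum_list u)" by (rule fact_fact_dvd_fact)
  finally show ?case by simp
qed simp

text \<open>The default 0 stands for the entry after the last one: the final factor gets exponent 0,
  and the empty list needs no separate formula.\<close>

lemma path_weight_nth:
  "path_weight r u = q_int r ^ nth_default 0 u 0 * qv ^ (\<Sum>i<length u. (u ! i) choose 2) *
     (\<Prod>i<length u. q_int (u ! i) ^ nth_default 0 u (Suc i) / of_nat (fact (u ! i)))"
  by (induction u arbitrary: r)
     (simp_all add: sum.lessThan_Suc_shift prod.lessThan_Suc_shift power_add mult_ac
        del: sum.lessThan_Suc prod.lessThan_Suc of_nat_fact)

lemma comp_term_eq:
  assumes "u \<noteq> []"
  shows "comp_term r u = of_nat (fact (sum_list u)) * path_weight r u"
proof -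
  obtain m where m: "length u = Suc m" using assms by (cases u) auto
  \<comment> \<open>The factor at the last index has exponent 0, so the product loses one
    index.\<close>
  have *: "(\<Prod>i<length u. q_int (u ! i) ^ nth_default 0 u (Suc i)) =
      (\<Prod>i<length u - 1. q_int (u ! i) ^ (u ! Suc i))"
    by (simp add: m nth_default_def)
  have "of_nat (multinomial u) * (\<Prod>i<length u. of_nat (fact (u ! i))) =
      (of_nat (multinomial u * (\<Prod>x\<leftarrow>u. fact x)) :: qrat)"
    by (simp add: prod.list_conv_set_nth atLeast0LessThan del: of_nat_fact)
  also have "multinomial u * (\<Prod>x\<leftarrow>u. fact x) = fact (sum_list u)"
    unfolding multinomial_def using prod_list_fact_dvd by simp
  finally have "of_nat (fact (sum_list u)) / (\<Prod>i<length u. of_nat (fact (u ! i))) =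
      (of_nat (multinomial u) :: qrat)"
    by (simp add: field_simps del: of_nat_fact)
  then show ?thesis
    using assms unfolding comp_term_def path_weight_nth prod_dividef *
    by (simp add: nth_default_def mult_ac del: of_nat_fact)
       (metis (no_types, lifting) mult.commute times_divide_eq_right)
qed

section \<open>Summands indexed by finitely supported sequences\<close>

text \<open>Beyond the support every factor is \<open>q_int 0 ^ 0 / fact 0 = 1\<close>, so any bound
  on the support turns the infinite product into a finite one.\<close>

lemma seq_term_superset:
  assumes "Poly_Mapping.keys u \<subseteq> {..<M}"
  shows "seq_term r u = q_int r ^ Poly_Mapping.lookup u 0 *
     qv ^ (\<Sum>i<M. Poly_Mapping.lookup u i choose 2) *
     (\<Prod>i<M. q_int (Poly_Mapping.lookup u i) ^ Poly_Mapping.lookup u (Suc i)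
            / of_nat (fact (Poly_Mapping.lookup u i)))"
proof -
  let ?g = "\<lambda>i. q_int (Poly_Mapping.lookup u i) ^ Poly_Mapping.lookup u (Suc i)
            / of_nat (fact (Poly_Mapping.lookup u i))"
  have zero: "Poly_Mapping.lookup u i = 0" if "i \<ge> M" for i
    using assms that by (meson in_keys_iff lessThan_iff linorder_not_less subsetD)
  have "(\<Sum>i\<in>Poly_Mapping.keys u. Poly_Mapping.lookup u i choose 2) =
        (\<Sum>i<M. Poly_Mapping.lookup u i choose 2)"
    using assms by (intro sum.mono_neutral_left) (auto simp: in_keys_iff binomial_eq_0)
  moreover have "{i. ?g i \<noteq> 1} \<subseteq> {..<M}"
  proof
    fix i assume "i \<in> {i. ?g i \<noteq> 1}"
    then show "i \<in> {..<M}" using zero[of i] zero[of "Suc i"] by (cases "i < M") auto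
  qed
  then have "(\<Prod>i. ?g i) = (\<Prod>i<M. ?g i)"
    by (intro Prod_any.expand_superset) auto
  ultimately show ?thesis by (simp add: seq_term_def)
qed

lemma keys_nth_subset: "Poly_Mapping.keys (Poly_Mapping.nth u) \<subseteq> {..<length u}"
  by (auto simp del: keys_nth simp: in_keys_iff nth_default_def split: if_splits)

lemma seq_term_nth: "seq_term r (Poly_Mapping.nth u) = path_weight r u"
  by (simp add: seq_term_superset[OF keys_nth_subset] path_weight_nth nth_default_nth
      cong: sum.cong_simp prod.cong_simp)

lemma mono_degree_nth: "mono_degree (Poly_Mapping.nth u) = sum_list u"
  by (simp add: mono_degree_superset[OF finite_lessThan keys_nth_subset] nth_default_nth
      sum_list_sum_nth atLeast0LessThan cong: sum.cong_simp)

text \<open>Since \<open>q_int 0 = 0\<close>, a zero entry followed by a positive one kills the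
  product. Hence the support is an initial segment and the sequence is a positive list padded with
  zeros.\<close>

lemma seq_term_nonzero_imp_nth:
  assumes "seq_term r u \<noteq> 0"
  shows "\<exists>xs. (\<forall>x\<in>set xs. 0 < x) \<and> u = Poly_Mapping.nth xs"
proof -
  let ?g = "\<lambda>i. q_int (Poly_Mapping.lookup u i) ^ Poly_Mapping.lookup u (Suc i)
            / of_nat (fact (Poly_Mapping.lookup u i))"
  have "(\<Prod>i. ?g i) \<noteq> 0" using assms unfolding seq_term_def by auto
  then have nz: "?g i \<noteq> 0" for i
    using Prod_any_zero[OF finite_seq_factors] by blast
  have step: "Poly_Mapping.lookup u (Suc i) = 0" if "Poly_Mapping.lookup u i = 0" for i
    using nz[of i] that by (auto simp: q_int_def intro: gr0I)
  have "\<exists>i. Poly_Mapping.lookup u i = 0"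
    using ex_new_if_finite[OF infinite_UNIV_nat finite_keys[of u]] by (auto simp: in_keys_iff)
  \<comment> \<open>The position of the first zero, which is the length of the list sought.\<close>
  define m where "m = (LEAST i. Poly_Mapping.lookup u i = 0)"
  have m: "Poly_Mapping.lookup u m = 0"
    unfolding m_def by (rule LeastI_ex) fact
  have pos: "0 < Poly_Mapping.lookup u i" if "i < m" for i
    using not_less_Least[of i] that unfolding m_def by auto
  have "Poly_Mapping.lookup u i = 0" if "m \<le> i" for i
    using that by (induction i rule: dec_induct) (simp_all add: m step)
  then have "u = Poly_Mapping.nth (map (Poly_Mapping.lookup u) [0..<m])"
    by (intro poly_mapping_eqI) (simp add: nth_default_def)
  then show ?thesis using pos by (intro exI[of _ "map (Poly_Mapping.lookup u) [0..<m]"]) auto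
qed

text \<open>Positivity lets the length be read off the padded sequence: the nonzero positions are
  exactly the indices of the list.\<close>

lemma inj_on_nth_positive: "inj_on Poly_Mapping.nth {u. \<forall>x\<in>set u. (0::nat) < x}"
proof (rule inj_onI)
  fix u v :: "nat list"
  assume uv: "u \<in> {u. \<forall>x\<in>set u. 0 < x}" "v \<in> {u. \<forall>x\<in>set u. 0 < x}"
    and "Poly_Mapping.nth u = Poly_Mapping.nth v"
  then have eq: "nth_default 0 u i = nth_default 0 v i" for i by (metis lookup_nth)
  have len: "i < length w \<longleftrightarrow> nth_default 0 w i \<noteq> 0" if "\<forall>x\<in>set w. 0 < x" for i and w :: "nat list"
    using that by (force simp: nth_default_def)
  have "i < length u \<longleftrightarrow> i < length v" for i using uv len eq by simp
  then have "length u = length v" by (metis linorder_neqE_nat less_irrefl)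
  then show "u = v" using eq by (auto intro!: nth_equalityI simp: nth_default_def) metis
qed

text \<open>All nonzero terms come from positive lists by zero padding, which is injective on them,
  so the infinite sum can be reindexed.\<close>

lemma Sum_any_seq_term:
  "(\<Sum>u. if mono_degree u = N then seq_term r u else 0) = (\<Sum>u\<in>positive_lists N. path_weight r u)"
proof -
  have "{u. (if mono_degree u = N then seq_term r u else 0) \<noteq> 0} \<subseteq>
      Poly_Mapping.nth ` positive_lists N"
    using seq_term_nonzero_imp_nth
    by (fastforce simp: positive_lists_def mono_degree_nth split: if_splits)
  then have "(\<Sum>u. if mono_degree u = N then seq_term r u else 0) =
      (\<Sum>u\<in>Poly_Mapping.nth ` positive_lists N. if mono_degree u = N then seq_term r u else 0)"
    by (intro Sum_any.expand_superset) (simp_all add: finite_positive_lists)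
  also have "\<dots> = (\<Sum>u\<in>positive_lists N. path_weight r u)"
    by (subst sum.reindex[OF inj_on_subset[OF inj_on_nth_positive]])
       (auto simp: positive_lists_def mono_degree_nth seq_term_nth intro!: sum.cong)
  finally show ?thesis .
qed

theorem theorem8p2:
  fixes \<phi> :: "qrat symfun \<Rightarrow> qrat"
  assumes "alg_hom \<phi>"
    and "\<And>n. n \<ge> 1 \<Longrightarrow> \<phi> (elem_sym n) = qv ^ (n choose 2) / of_nat (fact n)"
  shows "(\<forall>n r. 1 \<le> r \<and> r < n \<longrightarrow>
            J \<phi> n r = (\<Sum>u\<in>compositions (n - r). comp_term r u)) \<and>
         (\<forall>n r. r \<le> n \<longrightarrow>
            J \<phi> n r = of_nat (fact (n - r)) *
              (\<Sum>u. if mono_degree u = n - r then seq_term r u else 0))"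
proof -
  interpret q_exponential_specialization \<phi>
    using assms by unfold_locales
  have J: "J \<phi> n r = of_nat (fact (n - r)) * (\<Sum>u\<in>positive_lists (n - r). path_weight r u)"
    if "r \<le> n" for n r
    using J_eq_sum_path_weight[of r "n - r"] that by (simp add: field_simps del: of_nat_fact)
  \<comment> \<open>As \<open>n - r > 0\<close>, the empty list is excluded and
    \<open>compositions\<close> agrees with \<open>positive_lists\<close>.\<close>
  have "J \<phi> n r = (\<Sum>u\<in>compositions (n - r). comp_term r u)" if "r < n" for n r
  proof -
    have "(\<Sum>u\<in>compositions (n - r). comp_term r u) =
        (\<Sum>u\<in>compositions (n - r). of_nat (fact (n - r)) * path_weight r u)"
      by (rule sum.cong) (auto simp: comp_term_eq compositions_def)
    then show ?thesis
      using that by (simp add: J compositions_eq sum_distrib_left del: of_nat_fact)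
  qed
  then show ?thesis using J by (simp add: Sum_any_seq_term)
qed

end
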